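(* Let $k\ge 1$ be an integer and let $S\subset\mathbb{R}^2$ be a $2$-dimensional $k$-crystal. Then its Helly number satisfies $h(S)\leq k+6$.
   Context: Helly number: for a non-empty set $S\subseteq\mathbb{R}^d$, the $S$-Helly number $h(S)$ is the minimal positive integer $n$ with the following property: for every finite family $\mathcal{F}$ of convex sets in $\mathbb{R}^d$ with at least $n$ members, if every $n$ sets from $\mathcal{F}$ have a common point belonging to $S$, then all sets from $\mathcal{F}$ have a common point belonging to $S$. If no such $n$ exists, $h(S)=\infty$. Crystal: let $\Lambda$ be a full rank lattice in $\mathbb{R}^d$, i.e. the set of all integer linear combinations of a basis of $\mathbb{R}^d$, and let $\mathbf{t}_1,\ldots,\mathbf{t}_k\in\mathbb{R}^d$ be vectors such that $\mathbf{t}_i-\mathbf{t}_j\notin\Lambda$ for all $i\neq j$. The set $\bigcup_{i=1}^k(\Lambda+\mathbf{t}_i)$ is called a $d$-dimensional $k$-crystal. *)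

theory Defs
  imports "HOL-Analysis.Analysis" "HOL-Library.Extended_Nat"
begin

(* Families are sets of sets. Allowing repeated members (indexed families) would give the
   same notion: repetitions change neither the hypothesis nor the conclusion once n \<ge> 1. *)
definition helly_property :: "'a::euclidean_space set \<Rightarrow> nat \<Rightarrow> bool" where
  "helly_property S n \<longleftrightarrow>
     (\<forall>\<F> :: 'a set set. finite \<F> \<and> (\<forall>C\<in>\<F>. convex C) \<and> n \<le> card \<F> \<and>
        (\<forall>\<G>. \<G> \<subseteq> \<F> \<and> card \<G> = n \<longrightarrow> \<Inter>\<G> \<inter> S \<noteq> {})
        \<longrightarrow> \<Inter>\<F> \<inter> S \<noteq> {})"

(* The infimum of a non-empty set of extended naturals is its minimum; the infimum of the
   empty set is \<infinity>. *)
definition helly_number :: "'a::euclidean_space set \<Rightarrow> enat" where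
  "helly_number S = Inf {enat n | n. n \<ge> 1 \<and> helly_property S n}"

(* The basis B is automatically finite, so the sum is not vacuous. *)
definition full_rank_lattice :: "'a::euclidean_space set \<Rightarrow> bool" where
  "full_rank_lattice \<Lambda> \<longleftrightarrow>
     (\<exists>B. independent B \<and> span B = UNIV \<and>
        \<Lambda> = {(\<Sum>b\<in>B. of_int (c b) *\<^sub>R b) | c :: 'a \<Rightarrow> int. True})"

(* The dimension of the crystal is that of the ambient type. *)
definition is_crystal :: "nat \<Rightarrow> 'a::euclidean_space set \<Rightarrow> bool" where
  "is_crystal k S \<longleftrightarrow>
     (\<exists>\<Lambda> t. full_rank_lattice \<Lambda> \<and>
        (\<forall>i\<in>{1..k}. \<forall>j\<in>{1..k}. i \<noteq> j \<longrightarrow> t i - t j \<notin> \<Lambda>) \<and>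
        S = (\<Union>i\<in>{1..k}. (\<lambda>x. x + t i) ` \<Lambda>))"

end

theory Submission
  imports Defs
begin

text \<open>
  By a discrete form of Hoffman's theorem it suffices to bound the number of vertices of a polygon
  \<open>K\<close> with vertex set \<open>Q \<subseteq> S\<close> and no further point of \<open>S\<close>. A longest chord of \<open>K\<close> in a lattice
  direction \<open>v\<close> can be chosen through a vertex, so if it were longer than \<open>v\<close>, translating that vertex
  by \<open>v\<close> or \<open>- v\<close> would give a point of \<open>S\<close> in \<open>K\<close> that is not a vertex. Hence \<open>K - K\<close> has no nonzero
  lattice point in its interior, every lattice vector \<open>v\<close> that is a difference of vertices lies on
  its boundary, and at most two pairs of vertices have difference \<open>v\<close>. Two such vectors
  \<open>v \<noteq> \<plusminus> w\<close> congruent modulo 2 force \<open>K\<close> to be a parallelogram. Otherwise there are at most three of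
  them up to sign, and therefore at most \<open>3 \<cdot> 2\<close> vertices outside a system of representatives of
  the \<open>k\<close> cosets.
\<close>

section \<open>Convex hulls and their traces on finite sets\<close>

definition convex_position :: "'a::real_vector set \<Rightarrow> bool" where
  "convex_position Q \<longleftrightarrow> (\<forall>q\<in>Q. q \<notin> convex hull (Q - {q}))"

text \<open>Substituting one convex combination into the other and solving for \<open>x\<close>
  writes \<open>x\<close> as a convex combination of two points \<open>a\<close>, \<open>b\<close>
  of \<open>convex hull K\<close>.\<close>

lemma convex_hull_anti_exchange:
  assumes "x \<notin> convex hull K" "x \<noteq> y"
    and y: "y \<in> convex hull (insert x K)" and x: "x \<in> convex hull (insert y K)"
  shows False
proof (cases "K = {}")
  case True
  then show ?thesis using assms by simp
next
  case False
  obtain s a where s: "0 \<le> s" "s \<le> 1" "a \<in> convex hull K" "y = (1 - s) *\<^sub>R x + s *\<^sub>R a"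
    using y False unfolding convex_hull_insert_alt by auto
  obtain t b where t: "0 \<le> t" "t \<le> 1" "b \<in> convex hull K" "x = (1 - t) *\<^sub>R y + t *\<^sub>R b"
    using x False unfolding convex_hull_insert_alt by auto
  have t0: "t \<noteq> 0" using t(4) assms(2) by auto
  \<comment> \<open>This is the coefficient left on \<open>x\<close> after the substitution; it is
    positive because \<open>t\<close> is nonzero.\<close>
  define d where "d = 1 - (1 - t) * (1 - s)"
  have d: "d = t + (1 - t) * s" by (simp add: d_def algebra_simps)
  have "0 \<le> (1 - t) * s" using s t by simp
  then have d0: "d > 0" using t0 t(1) unfolding d by linarith
  have "x = (1 - t) *\<^sub>R ((1 - s) *\<^sub>R x + s *\<^sub>R a) + t *\<^sub>R b"
    using t(4) s(4) by simp
  then have "d *\<^sub>R x = ((1 - t) * s) *\<^sub>R a + t *\<^sub>R b"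
    by (simp add: d_def algebra_simps)
  moreover have "x = (1 / d) *\<^sub>R (d *\<^sub>R x)"
    using d0 by simp
  ultimately have "x = ((1 - t) * s / d) *\<^sub>R a + (t / d) *\<^sub>R b"
    by (simp add: scaleR_add_right)
  moreover have "((1 - t) * s / d) *\<^sub>R a + (t / d) *\<^sub>R b \<in> convex hull K"
    using s t d0 by (intro convexD[OF convex_convex_hull])
      (auto simp: d add_divide_distrib[symmetric] add.commute)
  ultimately show ?thesis using assms(1) by simp
qed

text \<open>Adjoin the point whose new hull catches the fewest points of \<open>T\<close>. By
  anti-exchange, any further point caught could be adjoined instead and would catch strictly
  fewer.\<close>

lemma convex_trace_extend_by_point:
  assumes "finite T" "K \<subset> T" "convex hull K \<inter> T = K"
  obtains x where "x \<in> T" "x \<notin> K" "convex hull (insert x K) \<inter> T = insert x K"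
proof -
  let ?m = "\<lambda>x. card (convex hull (insert x K) \<inter> T)"
  obtain x where x: "x \<in> T - K" and min: "\<And>y. y \<in> T - K \<Longrightarrow> ?m x \<le> ?m y"
    using ex_has_least_nat[of "\<lambda>x. x \<in> T - K" _ ?m] assms(2) by blast
  have "y \<in> insert x K" if y: "y \<in> convex hull (insert x K)" "y \<in> T" for y
  proof (rule ccontr)
    assume n: "y \<notin> insert x K"
    have sub: "convex hull (insert y K) \<subseteq> convex hull (insert x K)"
      using y(1) by (intro hull_minimal) (auto intro: hull_inc)
    have "x \<notin> convex hull K" using x assms(3) by blast
    then have "x \<notin> convex hull (insert y K)"
      using convex_hull_anti_exchange[of x K y] y(1) n by auto
    moreover have "x \<in> convex hull (insert x K)" by (simp add: hull_inc)
    ultimately have "convex hull (insert y K) \<inter> T \<subset> convex hull (insert x K) \<inter> T"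
      using sub x by blast
    then have "?m y < ?m x" using assms(1) by (intro psubset_card_mono) auto
    with min[of y] y(2) n show False by auto
  qed
  then have "convex hull (insert x K) \<inter> T = insert x K"
    using x assms(2) by (auto intro: hull_inc)
  with x that show thesis by blast
qed

text \<open>Enlarging the traces on \<open>T\<close> of the members of a critical family one point at a time
  until each of them is maximal yields, for each member, a witness missed by this member only.\<close>
lemma maximal_convex_traces:
  fixes T :: "'a::real_vector set" and p :: "'b \<Rightarrow> 'a"
  assumes finT: "finite T" and finI: "finite I"
    and conv: "\<And>i. i \<in> I \<Longrightarrow> convex hull (K i) \<inter> T = K i"
    and empty: "\<Inter>(K ` I) \<inter> T = {}"
    and pT: "\<And>i. i \<in> I \<Longrightarrow> p i \<in> T"
    and pK: "\<And>i j. i \<in> I \<Longrightarrow> j \<in> I \<Longrightarrow> i \<noteq> j \<Longrightarrow> p i \<in> K j"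
  obtains Q where "Q \<subseteq> T" "card Q = card I" "convex_position Q" "convex hull Q \<inter> T \<subseteq> Q"
proof -
  \<comment> \<open>The last clause keeps every trace different from \<open>T\<close>: if
    \<open>\<kappa> i = T\<close>, then \<open>p i\<close> would lie in all traces.\<close>
  define P where "P \<kappa> \<longleftrightarrow> (\<forall>i\<in>I. convex hull (\<kappa> i) \<inter> T = \<kappa> i) \<and> \<Inter>(\<kappa> ` I) \<inter> T = {} \<and>
    (\<forall>i\<in>I. \<forall>j\<in>I. i \<noteq> j \<longrightarrow> p i \<in> \<kappa> j)" for \<kappa> :: "'b \<Rightarrow> 'a set"
  let ?m = "\<lambda>\<kappa>. \<Sum>i\<in>I. card (\<kappa> i)"
  have "P K" using conv empty pK by (auto simp: P_def)
  moreover have "\<forall>\<kappa>. P \<kappa> \<longrightarrow> ?m \<kappa> < card I * card T + 1"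
  proof (intro allI impI)
    fix \<kappa> assume "P \<kappa>"
    then have "card (\<kappa> i) \<le> card T" if "i \<in> I" for i
      using that finT unfolding P_def by (metis card_mono inf_le2)
    then have "?m \<kappa> \<le> (\<Sum>i\<in>I. card T)" by (intro sum_mono)
    then show "?m \<kappa> < card I * card T + 1" by simp
  qed
  ultimately obtain \<kappa> where \<kappa>: "P \<kappa>" and max: "\<And>\<kappa>'. P \<kappa>' \<Longrightarrow> ?m \<kappa>' \<le> ?m \<kappa>"
    using ex_has_greatest_nat[of P K ?m] by blast
  have conv': "convex hull (\<kappa> i) \<inter> T = \<kappa> i" if "i \<in> I" for i
    using \<kappa> that by (auto simp: P_def)
  have sub: "\<kappa> i \<subseteq> T" if "i \<in> I" for i using conv'[OF that] by blast
  have "\<exists>x. x \<in> T \<and> x \<notin> \<kappa> i \<and> convex hull (insert x (\<kappa> i)) \<inter> T = insert x (\<kappa> i)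
      \<and> (\<forall>j\<in>I. j \<noteq> i \<longrightarrow> x \<in> \<kappa> j)" if i: "i \<in> I" for i
  proof -
    have "\<kappa> i \<noteq> T"
    proof
      assume "\<kappa> i = T"
      then have "p i \<in> \<Inter>(\<kappa> ` I) \<inter> T" using \<kappa> pT i unfolding P_def by (metis IntI INT_I)
      then show False using \<kappa> by (auto simp: P_def)
    qed
    then obtain x where x: "x \<in> T" "x \<notin> \<kappa> i"
        "convex hull (insert x (\<kappa> i)) \<inter> T = insert x (\<kappa> i)"
      using convex_trace_extend_by_point[OF finT _ conv'[OF i]] sub[OF i] by blast
    \<comment> \<open>By maximality the enlarged family violates \<open>P\<close>, and the only
      clause that can fail is the empty intersection. A common point of the new traces lies in every
      other \<open>\<kappa> j\<close>, so it must be the added point \<open>x\<close>.\<close>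
    define \<kappa>' where "\<kappa>' = \<kappa>(i := insert x (\<kappa> i))"
    have fin: "finite (\<kappa> i)" using finite_subset[OF sub[OF i] finT] .
    have "?m \<kappa> < ?m \<kappa>'"
      using i finI x(2) fin by (intro sum_strict_mono_ex1) (auto simp: \<kappa>'_def)
    then have "\<not> P \<kappa>'" using max by fastforce
    moreover have "\<forall>j\<in>I. convex hull (\<kappa>' j) \<inter> T = \<kappa>' j"
      using conv' x(3) by (auto simp: \<kappa>'_def)
    moreover have "\<forall>j\<in>I. \<forall>l\<in>I. j \<noteq> l \<longrightarrow> p j \<in> \<kappa>' l"
      using \<kappa> by (auto simp: P_def \<kappa>'_def)
    ultimately obtain y where y: "y \<in> \<Inter>(\<kappa>' ` I)" "y \<in> T" by (auto simp: P_def)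
    have y': "y \<in> \<kappa> j" if "j \<in> I" "j \<noteq> i" for j using y(1) that by (auto simp: \<kappa>'_def split: if_splits)
    have "y \<in> insert x (\<kappa> i)" using y(1) i by (auto simp: \<kappa>'_def)
    moreover have "y \<notin> \<kappa> i" using \<kappa> y' y(2) i unfolding P_def by blast
    ultimately have "y = x" by simp
    with y' x show ?thesis by blast
  qed
  then obtain q where q: "\<And>i. i \<in> I \<Longrightarrow> q i \<in> T" "\<And>i. i \<in> I \<Longrightarrow> q i \<notin> \<kappa> i"
      "\<And>i. i \<in> I \<Longrightarrow> convex hull (insert (q i) (\<kappa> i)) \<inter> T = insert (q i) (\<kappa> i)"
      "\<And>i j. i \<in> I \<Longrightarrow> j \<in> I \<Longrightarrow> j \<noteq> i \<Longrightarrow> q i \<in> \<kappa> j"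
    by metis
  show thesis
  proof
    show "q ` I \<subseteq> T" using q by blast
    show "card (q ` I) = card I"
      using q(2,4) by (intro card_image inj_onI) metis
    show "convex_position (q ` I)"
      unfolding convex_position_def
    proof (intro ballI notI)
      fix y assume "y \<in> q ` I" and h: "y \<in> convex hull (q ` I - {y})"
      then obtain i where i: "i \<in> I" "y = q i" by blast
      have "q ` I - {y} \<subseteq> \<kappa> i" using q(4) i by auto
      then have "y \<in> convex hull \<kappa> i" using h hull_mono by blast
      then show False using conv'[OF i(1)] q(1,2) i by blast
    qed
    show "convex hull (q ` I) \<inter> T \<subseteq> q ` I"
    proof
      fix y assume y: "y \<in> convex hull (q ` I) \<inter> T"
      \<comment> \<open>Each enlarged trace contains all witnesses and is still convex relative to
        \<open>T\<close>, hence contains \<open>y\<close>; an original trace that misses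
        \<open>y\<close> then identifies \<open>y\<close> with its witness.\<close>
      have "y \<in> insert (q i) (\<kappa> i)" if "i \<in> I" for i
      proof -
        have "q ` I \<subseteq> insert (q i) (\<kappa> i)" using q(4) that by auto
        then show ?thesis using y q(3)[OF that] hull_mono by blast
      qed
      moreover have "y \<notin> \<Inter>(\<kappa> ` I)" using \<kappa> y by (auto simp: P_def)
      ultimately show "y \<in> q ` I" by blast
    qed
  qed
qed

section \<open>From the Helly property to empty polytopes\<close>

text \<open>A subfamily of least size without a common point in \<open>S\<close> is critical:
  dropping any member creates a common point. Its traces on a finite part of \<open>S\<close> yield
  an empty polytope with as many vertices as the subfamily has members.\<close>

lemma helly_property_if_empty_polytopes_small:
  fixes S :: "'a::euclidean_space set"
  assumes n: "n \<ge> 1"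
    and discrete: "\<And>A. bounded A \<Longrightarrow> finite (A \<inter> S)"
    and small: "\<And>Q. finite Q \<Longrightarrow> Q \<subseteq> S \<Longrightarrow> convex_position Q \<Longrightarrow> convex hull Q \<inter> S \<subseteq> Q \<Longrightarrow> card Q \<le> n"
  shows "helly_property S n"
  unfolding helly_property_def
proof (intro allI impI notI, elim conjE)
  fix F :: "'a set set"
  assume finF: "finite F" and convF: "\<forall>C\<in>F. convex C" and nF: "n \<le> card F"
    and inter: "\<forall>G. G \<subseteq> F \<and> card G = n \<longrightarrow> \<Inter>G \<inter> S \<noteq> {}" and none: "\<Inter>F \<inter> S = {}"
  define critical where "critical G \<longleftrightarrow> G \<subseteq> F \<and> \<Inter>G \<inter> S = {}" for G
  have "critical F" using none by (simp add: critical_def)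
  then obtain G where "critical G" and least: "\<And>G'. critical G' \<Longrightarrow> card G \<le> card G'"
    using ex_has_least_nat[of critical F card] by blast
  then have G: "G \<subseteq> F" "\<Inter>G \<inter> S = {}" by (simp_all add: critical_def)
  have finG: "finite G" using G finF finite_subset by blast
  \<comment> \<open>Otherwise \<open>G\<close> could be padded to exactly \<open>n\<close> members
    of \<open>F\<close>, which do have a common point in \<open>S\<close>.\<close>
  have "n < card G"
  proof (rule ccontr)
    assume "\<not> n < card G"
    then obtain H where "G \<subseteq> H" "H \<subseteq> F" "card H = n"
      using exists_subset_between[of G n F] nF G(1) finF by auto
    with inter G(2) show False by blast
  qed
  have "\<exists>x. x \<in> \<Inter>(G - {C}) \<inter> S" if "C \<in> G" for C
  proof -
    have "card (G - {C}) < card G" using that finG by (meson card_Diff1_less)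
    then have "\<not> critical (G - {C})" using least not_le by blast
    then show ?thesis using G(1) by (auto simp: critical_def)
  qed
  then obtain p where p: "\<And>C. C \<in> G \<Longrightarrow> p C \<in> \<Inter>(G - {C}) \<inter> S" by metis
  \<comment> \<open>Taking the whole hull of the witnesses makes emptiness relative to
    \<open>T\<close> carry over to \<open>S\<close>.\<close>
  define T where "T = convex hull (p ` G) \<inter> S"
  have finT: "finite T"
    unfolding T_def by (intro discrete bounded_convex_hull finite_imp_bounded finite_imageI finG)
  have pT: "p C \<in> T" if "C \<in> G" for C using p[OF that] that by (auto simp: T_def hull_inc)
  have hullT: "convex hull (C \<inter> T) \<inter> T = C \<inter> T" if "C \<in> G" for C
  proof -
    have "convex hull (C \<inter> T) \<subseteq> C" using convF G(1) that by (intro hull_minimal) auto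
    then show ?thesis by (auto intro: hull_inc)
  qed
  have emptyT: "\<Inter>((\<lambda>C. C \<inter> T) ` G) \<inter> T = {}" using G(2) by (auto simp: T_def)
  have pD: "p C \<in> D \<inter> T" if "C \<in> G" "D \<in> G" "C \<noteq> D" for C D using p pT that by auto
  obtain Q where Q: "Q \<subseteq> T" "card Q = card G" "convex_position Q"
      "convex hull Q \<inter> T \<subseteq> Q"
    by (rule maximal_convex_traces[OF finT finG hullT emptyT pT pD])
  have "convex hull Q \<subseteq> convex hull (p ` G)"
    using Q(1) by (intro hull_minimal) (auto simp: T_def)
  then have "convex hull Q \<inter> S \<subseteq> Q" using Q(4) by (auto simp: T_def)
  moreover have "finite Q" using Q(1) finT finite_subset by blast
  moreover have "Q \<subseteq> S" using Q(1) by (auto simp: T_def)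
  ultimately have "card Q \<le> n" using small Q(3) by blast
  with Q(2) \<open>n < card G\<close> show False by simp
qed

section \<open>Lines, chords and supporting functionals\<close>

text \<open>A quarter turn: \<open>rot a\<close> directs the lines on which the functional
  \<open>a\<close> is constant.\<close>

definition rot :: "real^2 \<Rightarrow> real^2" where
  "rot a = vector [- a $ 2, a $ 1]"

lemma rot_uminus: "rot (- a) = - rot a"
  by (simp add: rot_def vec_eq_iff forall_2)

lemma rot_eq_0_iff [simp]: "rot a = 0 \<longleftrightarrow> a = 0"
  by (auto simp: rot_def vec_eq_iff forall_2)

lemma orthogonal_imp_multiple_rot:
  fixes a d :: "real^2"
  assumes "a \<noteq> 0" "a \<bullet> d = 0"
  obtains t where "d = t *\<^sub>R rot a"
proof
  have n: "a \<bullet> a \<noteq> 0" using assms(1) by simp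
  have o: "a $ 1 * d $ 1 + a $ 2 * d $ 2 = 0" using assms(2) by (simp add: inner_vec_def sum_2)
  have aa: "a \<bullet> a = a $ 1 * a $ 1 + a $ 2 * a $ 2" by (simp add: inner_vec_def sum_2)
  \<comment> \<open>The numerator is \<open>rot a \<bullet> d\<close>, so this is the projection
    coefficient of \<open>d\<close> on \<open>rot a\<close>, which is as long as
    \<open>a\<close>.\<close>
  let ?t = "(a $ 1 * d $ 2 - a $ 2 * d $ 1) / (a \<bullet> a)"
  have "d $ 1 * (a \<bullet> a) = - a $ 2 * (a $ 1 * d $ 2 - a $ 2 * d $ 1)" using o unfolding aa by algebra
  moreover have "d $ 2 * (a \<bullet> a) = a $ 1 * (a $ 1 * d $ 2 - a $ 2 * d $ 1)" using o unfolding aa by algebra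
  ultimately show "d = ?t *\<^sub>R rot a"
    using n by (simp add: rot_def vec_eq_iff forall_2 nonzero_eq_divide_eq mult.commute)
qed

text \<open>Of three collinear points one lies between the other two, which convex position
  forbids.\<close>

lemma card_convex_position_Int_line:
  fixes a :: "real^2"
  assumes fin: "finite Q" and conv: "convex_position Q" and a: "a \<noteq> 0"
  shows "card {q\<in>Q. a \<bullet> q = c} \<le> 2"
proof (rule ccontr)
  assume "\<not> ?thesis"
  then have "3 \<le> card {q\<in>Q. a \<bullet> q = c}" by simp
  then obtain T where T: "T \<subseteq> {q\<in>Q. a \<bullet> q = c}" "card T = 3"
    by (rule obtain_subset_with_card_n)
  then obtain x y z where xyz: "T = {x, y, z}" "x \<noteq> y" "x \<noteq> z" "y \<noteq> z"
    by (auto simp: card_3_iff)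
  have Q: "x \<in> Q" "y \<in> Q" "z \<in> Q" and eq: "a \<bullet> x = c" "a \<bullet> y = c" "a \<bullet> z = c"
    using T(1) xyz(1) by auto
  have "\<exists>t. u - v = t *\<^sub>R rot a" if "u \<in> {x,y,z}" "v \<in> {x,y,z}" for u v
  proof -
    have "a \<bullet> (u - v) = 0" using that eq by (auto simp: inner_diff_right)
    then show ?thesis using orthogonal_imp_multiple_rot[OF a] by metis
  qed
  then have "collinear {x, y, z}" unfolding collinear_def by blast
  then have "between (y,z) x \<or> between (z,x) y \<or> between (x,y) z"
    by (simp add: collinear_between_cases)
  moreover have "\<not> between (u,v) t" if "t \<in> Q" "u \<in> Q" "v \<in> Q" "u \<noteq> t" "v \<noteq> t" for t u v
  proof
    assume "between (u,v) t"
    then have "t \<in> convex hull {u,v}" by (simp add: between_mem_segment segment_convex_hull)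
    moreover have "{u,v} \<subseteq> Q - {t}" using that by auto
    ultimately have "t \<in> convex hull (Q - {t})" using hull_mono by blast
    then show False using conv that(1) by (simp add: convex_position_def)
  qed
  ultimately show False using Q xyz by metis
qed

text \<open>A minimiser of \<open>a\<close> inside an open segment of \<open>K\<close> forces
  \<open>a\<close> to be constant on that segment, which therefore runs along \<open>rot a\<close>
  and leaves room on both sides.\<close>

lemma non_extreme_minimizer_movable:
  fixes a :: "real^2"
  assumes "convex K" "a \<noteq> 0" "y \<in> K" "\<not> y extreme_point_of K" and min: "\<And>z. z \<in> K \<Longrightarrow> a \<bullet> y \<le> a \<bullet> z"
  obtains r0 where "r0 > 0" "\<And>r. \<bar>r\<bar> \<le> r0 \<Longrightarrow> y + r *\<^sub>R rot a \<in> K"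
proof -
  obtain u v where uv: "u \<in> K" "v \<in> K" "y \<in> open_segment u v"
    using assms(3,4) by (auto simp: extreme_point_of_def)
  then obtain t where t: "u \<noteq> v" "0 < t" "t < 1" "y = (1 - t) *\<^sub>R u + t *\<^sub>R v"
    by (auto simp: in_segment)
  have y: "a \<bullet> y = (1 - t) * (a \<bullet> u) + t * (a \<bullet> v)" by (simp add: t(4) inner_add_right)
  have eq: "(1 - t) * (a \<bullet> u - a \<bullet> y) + t * (a \<bullet> v - a \<bullet> y) = 0" by (simp add: y algebra_simps)
  have "0 \<le> (1 - t) * (a \<bullet> u - a \<bullet> y)" "0 \<le> t * (a \<bullet> v - a \<bullet> y)"
    using min uv(1,2) t by simp_all
  then have "(1 - t) * (a \<bullet> u - a \<bullet> y) = 0" "t * (a \<bullet> v - a \<bullet> y) = 0" using eq by linarith+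
  then have "a \<bullet> (v - u) = 0" using t by (simp add: inner_diff_right)
  then obtain s where s: "v - u = s *\<^sub>R rot a" using orthogonal_imp_multiple_rot[OF assms(2)] by blast
  have s0: "s \<noteq> 0" using s t(1) by auto
  define \<delta> where "\<delta> = min t (1 - t)"
  have \<delta>: "\<delta> > 0" "\<delta> \<le> t" "\<delta> \<le> 1 - t" using t by (auto simp: \<delta>_def)
  show thesis
  proof
    show "\<delta> * \<bar>s\<bar> > 0" using \<delta> s0 by simp
    fix r assume "\<bar>r\<bar> \<le> \<delta> * \<bar>s\<bar>"
    then have "\<bar>r / s\<bar> \<le> \<delta>" using s0 by (simp add: abs_divide divide_le_eq)
    then have \<rho>: "0 \<le> t + r / s" "t + r / s \<le> 1" using \<delta> by linarith+
    have "r *\<^sub>R rot a = (r / s) *\<^sub>R (v - u)" using s s0 by simp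
    then have "y + r *\<^sub>R rot a = (1 - (t + r / s)) *\<^sub>R u + (t + r / s) *\<^sub>R v"
      by (simp add: t(4) algebra_simps)
    then show "y + r *\<^sub>R rot a \<in> K" using convexD_alt[OF assms(1) uv(1,2) \<rho>] by simp
  qed
qed

text \<open>A longest chord in a given direction can be slid along the two parallel supporting
  lines at its endpoints until it hits a vertex.\<close>
lemma longest_chord_through_extreme_point:
  fixes K :: "(real^2) set"
  assumes "compact K" "convex K" "a \<noteq> 0" "x0 \<in> K" "x0 + w \<in> K"
    and longest: "\<And>x y. x \<in> K \<Longrightarrow> y \<in> K \<Longrightarrow> a \<bullet> (x - y) \<le> a \<bullet> w"
  obtains x where "x \<in> K" "x + w \<in> K" "x extreme_point_of K \<or> (x + w) extreme_point_of K"
proof -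
  \<comment> \<open>\<open>M\<close> collects the starting points of the chords of \<open>K\<close>
    that are translates of \<open>w\<close>; sliding stops at an extreme point of
    \<open>M\<close>.\<close>
  define M where "M = K \<inter> (+) (- w) ` K"
  have M: "z \<in> M \<longleftrightarrow> z \<in> K \<and> z + w \<in> K" for z
    unfolding M_def by (auto simp: image_iff) (metis add_diff_cancel_right' uminus_add_conv_diff)
  have "compact M" "convex M"
    unfolding M_def using compact_Int[OF assms(1) compact_translation[OF assms(1)]]
      convex_Int[OF assms(2) convex_translation[OF assms(2)]] by blast+
  moreover have "M \<noteq> {}" using M assms(4,5) by blast
  ultimately obtain x where x: "x extreme_point_of M" by (rule extreme_point_exists_convex)
  then have xK: "x \<in> K" "x + w \<in> K" using M by (auto simp: extreme_point_of_def)
  have "x extreme_point_of K \<or> (x + w) extreme_point_of K"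
  proof (rule ccontr)
    assume n: "\<not> ?thesis"
    have min1: "a \<bullet> x \<le> a \<bullet> z" if "z \<in> K" for z
      using longest[OF xK(2) that] by (simp add: inner_diff_right inner_add_right)
    have min2: "(- a) \<bullet> (x + w) \<le> (- a) \<bullet> z" if "z \<in> K" for z
      using longest[OF that xK(1)] by (simp add: inner_diff_right inner_add_right)
    obtain r1 where r1: "r1 > 0" "\<And>r. \<bar>r\<bar> \<le> r1 \<Longrightarrow> x + r *\<^sub>R rot a \<in> K"
      using non_extreme_minimizer_movable[OF assms(2,3) xK(1) _ min1] n by blast
    \<comment> \<open>The far endpoint maximises \<open>a\<close>, hence minimises
      \<open>- a\<close>; the opposite sign of \<open>rot (- a)\<close> is absorbed by replacing
      \<open>r\<close> with \<open>- r\<close>.\<close>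
    have "- a \<noteq> 0" using assms(3) by simp
    then obtain r2 where r2: "r2 > 0" "\<And>r. \<bar>r\<bar> \<le> r2 \<Longrightarrow> x + w + r *\<^sub>R rot (- a) \<in> K"
      using non_extreme_minimizer_movable[OF assms(2) _ xK(2) _ min2] n by blast
    have r2': "x + w + r *\<^sub>R rot a \<in> K" if "\<bar>r\<bar> \<le> r2" for r
      using r2(2)[of "- r"] that by (simp add: rot_uminus)
    define r where "r = min r1 r2"
    have r: "r > 0" "\<bar>r\<bar> \<le> r1" "\<bar>r\<bar> \<le> r2" "\<bar>- r\<bar> \<le> r1" "\<bar>- r\<bar> \<le> r2"
      using r1(1) r2(1) by (auto simp: r_def)
    have "x + r *\<^sub>R rot a \<in> M" "x + (- r) *\<^sub>R rot a \<in> M"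
      unfolding M using r1(2)[OF r(2)] r2'[OF r(3)] r1(2)[OF r(4)] r2'[OF r(5)]
      by (simp_all add: algebra_simps)
    moreover have "x = midpoint (x + r *\<^sub>R rot a) (x + (- r) *\<^sub>R rot a)"
      by (simp add: midpoint_def vec_eq_iff)
    moreover have "x + r *\<^sub>R rot a \<noteq> x + (- r) *\<^sub>R rot a"
      using r(1) assms(3) by (simp del: scaleR_minus_left)
    ultimately have "x \<in> open_segment (x + r *\<^sub>R rot a) (x + (- r) *\<^sub>R rot a)"
      by (metis midpoint_in_open_segment)
    with x \<open>x + r *\<^sub>R rot a \<in> M\<close> \<open>x + (- r) *\<^sub>R rot a \<in> M\<close> show False
      by (auto simp: extreme_point_of_def)
  qed
  with xK that show thesis by blast
qed

text \<open>Separate \<open>D\<close> from the open ray of all \<open>t *\<^sub>R w\<close> with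
  \<open>t > 1\<close>, and let \<open>t\<close> tend to 1.\<close>

lemma supporting_functional_at_radial_maximum:
  fixes D :: "'a::euclidean_space set"
  assumes "convex D" "D \<noteq> {}" and radial: "\<And>t. t > 1 \<Longrightarrow> t *\<^sub>R w \<notin> D"
  obtains a where "a \<noteq> 0" "\<And>z. z \<in> D \<Longrightarrow> a \<bullet> z \<le> a \<bullet> w"
proof -
  define T where "T = (\<lambda>t. t *\<^sub>R w) ` {1<..}"
  have "convex T"
    unfolding T_def by (intro convex_linear_image) (auto intro!: linearI simp: scaleR_add_left)
  moreover have "T \<noteq> {}" "D \<inter> T = {}" using radial by (auto simp: T_def)
  ultimately obtain a b where ab: "a \<noteq> 0" "\<forall>x\<in>D. a \<bullet> x \<le> b" "\<forall>x\<in>T. b \<le> a \<bullet> x"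
    using separating_hyperplane_sets[of D T] assms(1,2) by blast
  have "b \<le> (1 + inverse (real (Suc n))) * (a \<bullet> w)" for n
  proof -
    have "(1 + inverse (real (Suc n))) *\<^sub>R w \<in> T" unfolding T_def by (intro imageI) simp
    then show ?thesis using ab(3) by (metis inner_scaleR_right)
  qed
  moreover have "(\<lambda>n. (1 + inverse (real (Suc n))) * (a \<bullet> w)) \<longlonglongrightarrow> (1 + 0) * (a \<bullet> w)"
    by (intro tendsto_intros LIMSEQ_inverse_real_of_nat)
  ultimately have "b \<le> (1 + 0) * (a \<bullet> w)"
    by (intro LIMSEQ_le_const) auto
  with ab that show thesis by fastforce
qed

section \<open>Empty polygons in a set invariant under lattice translations\<close>

text \<open>\<open>L\<close> stands for the lattice and \<open>S\<close> for the crystal. Having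
  more than four vertices excludes the parallelogram, the exceptional case in the count modulo
  2.\<close>

locale empty_polygon =
  fixes L S Q :: "(real^2) set"
  assumes finite_Q: "finite Q" and convex_position_Q: "convex_position Q"
    and empty: "convex hull Q \<inter> S \<subseteq> Q" and Q_subset: "Q \<subseteq> S"
    and uminus_L: "\<And>v. v \<in> L \<Longrightarrow> - v \<in> L"
    and shift: "\<And>x v. x \<in> S \<Longrightarrow> v \<in> L \<Longrightarrow> x + v \<in> S"
    and card_Q: "4 < card Q"
begin

abbreviation K where "K \<equiv> convex hull Q"

lemma Q_subset_K: "q \<in> Q \<Longrightarrow> q \<in> K"
  by (rule hull_inc)

lemma extreme_iff: "x extreme_point_of K \<longleftrightarrow> x \<in> Q"
  using finite_Q convex_position_Q
  by (intro extreme_point_of_convex_hull_convex_independent)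
    (auto simp: convex_position_def finite_imp_compact)

lemma not_in_open_segment: "q \<in> Q \<Longrightarrow> x \<in> K \<Longrightarrow> y \<in> K \<Longrightarrow> q \<notin> open_segment x y"
  using extreme_iff by (auto simp: extreme_point_of_def)

lemma functional_not_constant:
  assumes "a \<noteq> 0" obtains q where "q \<in> Q" "a \<bullet> q \<noteq> c"
proof -
  have "{q\<in>Q. a \<bullet> q = c} \<noteq> Q"
    using card_convex_position_Int_line[OF finite_Q convex_position_Q assms, of c] card_Q by auto
  with that show thesis by blast
qed

text \<open>The point \<open>r + v\<close> of \<open>S\<close> lies strictly inside the chord, so
  emptiness makes it a vertex although it is not extreme.\<close>

lemma no_long_chord_at_vertex:
  assumes "r \<in> Q" "v \<in> L" "v \<noteq> 0" "\<sigma> > 1" "r + \<sigma> *\<^sub>R v \<in> K"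
  shows False
proof -
  have "r + v = (1 - 1 / \<sigma>) *\<^sub>R r + (1 / \<sigma>) *\<^sub>R (r + \<sigma> *\<^sub>R v)"
    using assms(4) by (simp add: algebra_simps)
  then have seg: "r + v \<in> open_segment r (r + \<sigma> *\<^sub>R v)"
    using assms(3,4) unfolding in_segment by (intro conjI exI[of _ "1 / \<sigma>"]) auto
  then have "r + v \<in> K"
    using convex_contains_open_segment[of K] assms(1,5) Q_subset_K by (meson convex_convex_hull subsetD)
  moreover have "r + v \<in> S" using assms(1,2) Q_subset shift by blast
  ultimately have "r + v \<in> Q" using empty by blast
  with seg assms(1,5) not_in_open_segment Q_subset_K show False by blast
qed

text \<open>Otherwise take the longest chord in direction \<open>v\<close>. A functional supporting
  the difference set there lets the chord slide to a vertex, where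
  \<open>no_long_chord_at_vertex\<close> applies.\<close>

lemma no_long_chord:
  assumes v: "v \<in> L" "v \<noteq> 0" and x: "x \<in> K" "x + s *\<^sub>R v \<in> K"
  shows "s \<le> 1"
proof (rule ccontr)
  assume "\<not> s \<le> 1"
  define D where "D = {x - y |x y. x \<in> K \<and> y \<in> K}"
  have D_iff: "z \<in> D \<longleftrightarrow> (\<exists>x\<in>K. x + z \<in> K)" for z
    unfolding D_def by (smt (verit, best) add.commute diff_add_cancel mem_Collect_eq add_diff_cancel)
  have compK: "compact K" using finite_Q by (simp add: compact_convex_hull finite_imp_compact)
  then have compD: "compact D" unfolding D_def by (intro compact_differences)
  have "D = (\<Union>x\<in>K. \<Union>y\<in>K. {x - y})" by (auto simp: D_def)
  then have convD: "convex D" using convex_differences[of K K] by simp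
  \<comment> \<open>Compactness of \<open>A\<close> provides the largest multiple
    \<open>\<sigma>\<close> of \<open>v\<close> among the differences.\<close>
  define A where "A = (\<lambda>s. s *\<^sub>R v) -` D"
  have "closed A"
    unfolding A_def using compD by (intro continuous_closed_vimage compact_imp_closed) auto
  moreover have "bounded A"
  proof -
    obtain B where B: "\<And>z. z \<in> D \<Longrightarrow> norm z \<le> B"
      using compact_imp_bounded[OF compD] by (auto simp: bounded_iff)
    have "norm s \<le> B / norm v" if "s \<in> A" for s
      using B[of "s *\<^sub>R v"] that v(2) by (simp add: A_def le_divide_eq)
    then show ?thesis by (auto simp: bounded_iff)
  qed
  ultimately have "compact A" by (simp add: compact_eq_bounded_closed)
  moreover have sA: "s \<in> A" using x by (auto simp: A_def D_iff)
  ultimately obtain \<sigma> where \<sigma>: "\<sigma> \<in> A" "\<And>t. t \<in> A \<Longrightarrow> t \<le> \<sigma>"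
    using compact_attains_sup[of A] by blast
  have \<sigma>1: "\<sigma> > 1" using \<sigma>(2)[OF sA] \<open>\<not> s \<le> 1\<close> by simp
  define w where "w = \<sigma> *\<^sub>R v"
  have wD: "w \<in> D" using \<sigma>(1) by (simp add: A_def w_def)
  have "t *\<^sub>R w \<notin> D" if "t > 1" for t
  proof
    assume "t *\<^sub>R w \<in> D"
    then have "t * \<sigma> \<le> \<sigma>" using \<sigma>(2)[of "t * \<sigma>"] by (simp add: A_def w_def)
    with that \<sigma>1 show False by (simp add: mult_le_cancel_right1)
  qed
  then obtain a where a: "a \<noteq> 0" "\<And>z. z \<in> D \<Longrightarrow> a \<bullet> z \<le> a \<bullet> w"
    using supporting_functional_at_radial_maximum[OF convD, of w] wD by blast
  have longest: "a \<bullet> (x - y) \<le> a \<bullet> w" if "x \<in> K" "y \<in> K" for x y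
    using a(2)[of "x - y"] that by (auto simp: D_def)
  obtain x0 where x0: "x0 \<in> K" "x0 + w \<in> K" using wD D_iff by blast
  obtain r where r: "r \<in> K" "r + w \<in> K" "r extreme_point_of K \<or> (r + w) extreme_point_of K"
    by (rule longest_chord_through_extreme_point[OF compK convex_convex_hull a(1) x0 longest])
  from r(3) show False
  proof
    assume "r extreme_point_of K"
    then show False using no_long_chord_at_vertex[of r v \<sigma>] v \<sigma>1 r(2) extreme_iff w_def by simp
  next
    \<comment> \<open>If the vertex is the far endpoint, the chord is read backwards, with
      \<open>- v\<close> in place of \<open>v\<close>.\<close>
    assume "(r + w) extreme_point_of K"
    then show False
      using no_long_chord_at_vertex[of "r + w" "- v" \<sigma>] v \<sigma>1 r(1) extreme_iff uminus_L w_def by simp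
  qed
qed

text \<open>By \<open>no_long_chord\<close> the difference set of \<open>K\<close> contains no
  multiple of \<open>v\<close> beyond \<open>v\<close>, so it can be supported there: the width of
  \<open>K\<close> along \<open>a\<close> is at most \<open>a \<bullet> v\<close>.\<close>

lemma supporting_functional:
  assumes v: "v \<in> L" "v \<noteq> 0"
  obtains a where "a \<noteq> 0" "\<And>x y. x \<in> K \<Longrightarrow> y \<in> K \<Longrightarrow> a \<bullet> x - a \<bullet> y \<le> a \<bullet> v"
proof -
  define D where "D = (\<Union>x\<in>K. \<Union>y\<in>K. {x - y})"
  have "convex D" unfolding D_def by (intro convex_differences convex_convex_hull)
  moreover have "D \<noteq> {}" using card_Q by (force simp: D_def)
  moreover have "t *\<^sub>R v \<notin> D" if "t > 1" for t
  proof
    assume "t *\<^sub>R v \<in> D"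
    then obtain x y where "x \<in> K" "y \<in> K" "t *\<^sub>R v = x - y" by (auto simp: D_def)
    then show False using no_long_chord[OF v, of y t] that by simp
  qed
  ultimately obtain a where "a \<noteq> 0" "\<And>z. z \<in> D \<Longrightarrow> a \<bullet> z \<le> a \<bullet> v"
    using supporting_functional_at_radial_maximum[of D v] by blast
  moreover have "a \<bullet> x - a \<bullet> y \<le> a \<bullet> v" if "x \<in> K" "y \<in> K" for x y
    using calculation(2)[of "x - y"] that by (auto simp: D_def inner_diff_right)
  ultimately show thesis using that by blast
qed

text \<open>The width bound makes every such \<open>p\<close> a maximiser of \<open>a\<close> on
  \<open>Q\<close>, so all of them lie on one line.\<close>

lemma card_pairs_with_difference:
  assumes v: "v \<in> L" "v \<noteq> 0"
  shows "card {p\<in>Q. p - v \<in> Q} \<le> 2"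
proof (cases "{p\<in>Q. p - v \<in> Q} = {}")
  case True
  then show ?thesis by (simp only: card.empty)
next
  case False
  then obtain p where p: "p \<in> Q" "p - v \<in> Q" by blast
  obtain a where a: "a \<noteq> 0" "\<And>x y. x \<in> K \<Longrightarrow> y \<in> K \<Longrightarrow> a \<bullet> x - a \<bullet> y \<le> a \<bullet> v"
    by (rule supporting_functional[OF v]) blast
  have max: "a \<bullet> x \<le> a \<bullet> q" if "x \<in> Q" "q - v \<in> Q" for x q
    using a(2)[of x "q - v"] that by (simp add: Q_subset_K inner_diff_right)
  have "{p\<in>Q. p - v \<in> Q} \<subseteq> {q\<in>Q. a \<bullet> q = a \<bullet> p}"
    using max p by (auto intro!: antisym)
  then have "card {p\<in>Q. p - v \<in> Q} \<le> card {q\<in>Q. a \<bullet> q = a \<bullet> p}"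
    using finite_Q by (intro card_mono) auto
  then show ?thesis
    using card_convex_position_Int_line[OF finite_Q convex_position_Q a(1), of "a \<bullet> p"] by simp
qed

text \<open>Both half sums \<open>(v + w) / 2\<close> and \<open>(v - w) / 2\<close> would be longest differences in \<open>K\<close>, and the
  two pairs of supporting lines they determine enclose \<open>K\<close> in a parallelogram whose corners are
  the four given points.\<close>
lemma differences_not_congruent:
  assumes p: "p \<in> Q" "p + v \<in> Q" and q: "q \<in> Q" "q + w \<in> Q"
    and ne: "v \<noteq> w" "v \<noteq> - w"
    and half: "(1/2) *\<^sub>R (v + w) \<in> L" "(1/2) *\<^sub>R (v - w) \<in> L"
  shows False
proof -
  note inK = p[THEN Q_subset_K] q[THEN Q_subset_K]
  have "(1/2) *\<^sub>R (v + w) \<noteq> 0" using ne(2) by (simp add: add_eq_0_iff2)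
  with half(1) obtain a where a: "a \<noteq> 0"
    "\<And>x y. x \<in> K \<Longrightarrow> y \<in> K \<Longrightarrow> a \<bullet> x - a \<bullet> y \<le> a \<bullet> ((1/2) *\<^sub>R (v + w))"
    by (rule supporting_functional) blast
  have "(1/2) *\<^sub>R (v - w) \<noteq> 0" using ne(1) by simp
  with half(2) obtain b where b: "b \<noteq> 0"
    "\<And>x y. x \<in> K \<Longrightarrow> y \<in> K \<Longrightarrow> b \<bullet> x - b \<bullet> y \<le> b \<bullet> ((1/2) *\<^sub>R (v - w))"
    by (rule supporting_functional) blast
  define \<alpha>0 \<alpha>1 \<beta>0 \<beta>1 where "\<alpha>0 = a \<bullet> p" and "\<alpha>1 = a \<bullet> (p + v)" and "\<beta>0 = b \<bullet> p" and "\<beta>1 = b \<bullet> (p + v)"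
  have a': "a \<bullet> x - a \<bullet> y \<le> (a \<bullet> v + a \<bullet> w) / 2" if "x \<in> K" "y \<in> K" for x y
    using a(2)[OF that] by (simp add: inner_add_right)
  have b': "b \<bullet> x - b \<bullet> y \<le> (b \<bullet> v - b \<bullet> w) / 2" if "x \<in> K" "y \<in> K" for x y
    using b(2)[OF that] by (simp add: inner_diff_right)
  \<comment> \<open>Applying the width bounds to the two given chords themselves yields inequalities
    in both directions, here and for \<open>b\<close>.\<close>
  have avw: "a \<bullet> v = a \<bullet> w" using a'[OF inK(2,1)] a'[OF inK(4,3)] by (simp add: inner_add_right)
  have bvw: "b \<bullet> w = - (b \<bullet> v)" using b'[OF inK(2,1)] b'[OF inK(3,4)] by (simp add: inner_add_right)
  have a_le: "\<alpha>0 \<le> a \<bullet> x" "a \<bullet> x \<le> \<alpha>1" "a \<bullet> q \<le> a \<bullet> x" "a \<bullet> x \<le> a \<bullet> (q + w)" if "x \<in> K" for x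
    using a'[OF inK(2) that] a'[OF that inK(1)] a'[OF inK(4) that] a'[OF that inK(3)] avw
    by (simp_all add: \<alpha>0_def \<alpha>1_def inner_add_right)
  have b_le: "\<beta>0 \<le> b \<bullet> x" "b \<bullet> x \<le> \<beta>1" "b \<bullet> (q + w) \<le> b \<bullet> x" "b \<bullet> x \<le> b \<bullet> q" if "x \<in> K" for x
    using b'[OF inK(2) that] b'[OF that inK(1)] b'[OF that inK(4)] b'[OF inK(3) that] bvw
    by (simp_all add: \<beta>0_def \<beta>1_def inner_add_right)
  have aq: "a \<bullet> q = \<alpha>0" "a \<bullet> (q + w) = \<alpha>1"
    using a_le inK by (auto intro!: antisym simp: \<alpha>0_def \<alpha>1_def)
  have bq: "b \<bullet> q = \<beta>1" "b \<bullet> (q + w) = \<beta>0"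
    using b_le inK by (auto intro!: antisym simp: \<beta>0_def \<beta>1_def)
  obtain z where z: "z \<in> Q" "a \<bullet> z \<noteq> \<alpha>0" using functional_not_constant[OF a(1)] by blast
  then have \<alpha>: "\<alpha>0 < \<alpha>1" using a_le(1,2)[OF Q_subset_K[OF z(1)]] by simp
  obtain z where z: "z \<in> Q" "b \<bullet> z \<noteq> \<beta>0" using functional_not_constant[OF b(1)] by blast
  then have \<beta>: "\<beta>0 < \<beta>1" using b_le(1,2)[OF Q_subset_K[OF z(1)]] by simp
  \<comment> \<open>\<open>a\<close> agrees at \<open>p\<close> and \<open>q\<close> while
    \<open>b\<close> does not, so the two functionals are independent and together determine a
    point.\<close>
  have "a \<bullet> (q - p) = 0" using aq by (simp add: inner_diff_right \<alpha>0_def)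
  then obtain t where t: "q - p = t *\<^sub>R rot a" using orthogonal_imp_multiple_rot[OF a(1)] by blast
  have "b \<bullet> (q - p) \<noteq> 0" using bq \<beta> by (simp add: inner_diff_right \<beta>0_def)
  then have brot: "b \<bullet> rot a \<noteq> 0" using t by auto
  let ?C = "{p, p + v, q, q + w}"
  have "Q \<subseteq> ?C"
  proof
    fix x assume x: "x \<in> Q"
    \<comment> \<open>The relative positions of \<open>x\<close> between the two supporting lines of
      \<open>a\<close> and between those of \<open>b\<close>.\<close>
    define r s where "r = (a \<bullet> x - \<alpha>0) / (\<alpha>1 - \<alpha>0)" and "s = (b \<bullet> x - \<beta>0) / (\<beta>1 - \<beta>0)"
    have rs: "0 \<le> r" "r \<le> 1" "0 \<le> s" "s \<le> 1"
      using \<alpha> \<beta> a_le(1,2)[OF Q_subset_K[OF x]] b_le(1,2)[OF Q_subset_K[OF x]]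
      by (simp_all add: r_def s_def divide_le_eq)
    have ax: "a \<bullet> x = (1 - r) * \<alpha>0 + r * \<alpha>1"
    proof -
      have "r * (\<alpha>1 - \<alpha>0) = a \<bullet> x - \<alpha>0" using \<alpha> by (simp add: r_def)
      then show ?thesis by (simp add: algebra_simps)
    qed
    have bx: "b \<bullet> x = (1 - s) * \<beta>0 + s * \<beta>1"
    proof -
      have "s * (\<beta>1 - \<beta>0) = b \<bullet> x - \<beta>0" using \<beta> by (simp add: s_def)
      then show ?thesis by (simp add: algebra_simps)
    qed
    \<comment> \<open>Bilinear interpolation of the corners. The functional \<open>a\<close> takes
      one value at \<open>p\<close>, \<open>q\<close> and another at \<open>q + w\<close>,
      \<open>p + v\<close>; \<open>b\<close> takes one at \<open>p\<close>, \<open>q + w\<close> and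
      another at \<open>q\<close>, \<open>p + v\<close>. So \<open>y\<close> matches
      \<open>x\<close> under both.\<close>
    define y where "y = (1 - r) *\<^sub>R ((1 - s) *\<^sub>R p + s *\<^sub>R q) + r *\<^sub>R ((1 - s) *\<^sub>R (q + w) + s *\<^sub>R (p + v))"
    have y: "y \<in> convex hull ?C"
      unfolding y_def using rs by (intro convexD_alt[OF convex_convex_hull]) (auto intro: hull_inc)
    have "a \<bullet> y = (1 - r) * ((1 - s) * (a \<bullet> p) + s * (a \<bullet> q)) + r * ((1 - s) * (a \<bullet> (q + w)) + s * (a \<bullet> (p + v)))"
      unfolding y_def by (simp only: inner_add_right[of a "_ *\<^sub>R _"] inner_scaleR_right)
    also have "\<dots> = a \<bullet> x"
      unfolding ax aq \<alpha>0_def[symmetric] \<alpha>1_def[symmetric] by (simp add: algebra_simps)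
    finally have "a \<bullet> (x - y) = 0" by (simp add: inner_diff_right)
    then obtain u where u: "x - y = u *\<^sub>R rot a" using orthogonal_imp_multiple_rot[OF a(1)] by blast
    have "b \<bullet> y = (1 - r) * ((1 - s) * (b \<bullet> p) + s * (b \<bullet> q)) + r * ((1 - s) * (b \<bullet> (q + w)) + s * (b \<bullet> (p + v)))"
      unfolding y_def by (simp only: inner_add_right[of b "_ *\<^sub>R _"] inner_scaleR_right)
    also have "\<dots> = b \<bullet> x"
      unfolding bx bq \<beta>0_def[symmetric] \<beta>1_def[symmetric] by (simp add: algebra_simps)
    finally have "b \<bullet> (x - y) = 0" by (simp add: inner_diff_right)
    then have "u = 0" using brot u by simp
    then have "x \<in> convex hull ?C" using u y by simp
    show "x \<in> ?C"
    proof (rule ccontr)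
      assume "x \<notin> ?C"
      then have "?C \<subseteq> Q - {x}" using p q by auto
      then have "x \<in> convex hull (Q - {x})" using \<open>x \<in> convex hull ?C\<close> hull_mono by blast
      then show False using convex_position_Q x by (auto simp: convex_position_def)
    qed
  qed
  then have "card Q \<le> card ?C" by (intro card_mono) auto
  also have "\<dots> \<le> 4" by (simp add: card_insert_if)
  finally show False using card_Q by simp
qed

text \<open>Every point other than the chosen representative of its coset is charged to its difference
  from the representative. Up to sign these differences are determined by their classes
  modulo 2, and each is charged at most twice.\<close>
lemma card_le_cosets:
  assumes I: "finite I" "\<And>q. q \<in> Q \<Longrightarrow> \<iota> q \<in> I"
    and coset: "\<And>p q. p \<in> Q \<Longrightarrow> q \<in> Q \<Longrightarrow> \<iota> p = \<iota> q \<Longrightarrow> p - q \<in> L"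
    and R: "finite R" "card R = 4" "z \<in> R" "\<And>v. v \<in> L \<Longrightarrow> f v \<in> R"
    and half: "\<And>v. v \<in> L \<Longrightarrow> f v = z \<Longrightarrow> (1/2) *\<^sub>R v \<in> L"
    and congr: "\<And>v w. v \<in> L \<Longrightarrow> w \<in> L \<Longrightarrow> f v = f w \<Longrightarrow>
      (1/2) *\<^sub>R (v + w) \<in> L \<and> (1/2) *\<^sub>R (v - w) \<in> L"
  shows "card Q \<le> card I + 6"
proof -
  define rep where "rep i = (SOME q. q \<in> Q \<and> \<iota> q = i)" for i
  have rep: "rep (\<iota> q) \<in> Q" "\<iota> (rep (\<iota> q)) = \<iota> q" if "q \<in> Q" for q
    using someI[of "\<lambda>p. p \<in> Q \<and> \<iota> p = \<iota> q" q] that by (auto simp: rep_def)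
  define N where "N = {q\<in>Q. rep (\<iota> q) \<noteq> q}"
  define d where "d q = q - rep (\<iota> q)" for q
  have NQ: "q \<in> Q" if "q \<in> N" for q using that by (simp add: N_def)
  have d: "d q \<in> L" "d q \<noteq> 0" if "q \<in> N" for q
    using coset[of q "rep (\<iota> q)"] rep[of q] that by (auto simp: d_def N_def)
  have not_rep: "p \<noteq> rep (\<iota> q)" if "p \<in> N" "q \<in> N" for p q
  proof
    assume eq: "p = rep (\<iota> q)"
    then have "\<iota> p = \<iota> q" using rep(2)[OF NQ[OF that(2)]] by simp
    with eq that(1) show False by (simp add: N_def)
  qed
  have fin: "finite N" using finite_Q by (simp add: N_def)
  have "Q - N \<subseteq> rep ` I" using I(2) by (force simp: N_def)
  then have 1: "card (Q - N) \<le> card I" using I(1) surj_card_le by blast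
  \<comment> \<open>A difference in the zero class is twice a lattice vector, which makes the chord
    from the representative too long.\<close>
  have fz: "f (d q) \<noteq> z" if q: "q \<in> N" for q
  proof
    assume "f (d q) = z"
    then have "(1/2) *\<^sub>R d q \<in> L" using half d q by blast
    moreover have "rep (\<iota> q) + 2 *\<^sub>R ((1/2) *\<^sub>R d q) \<in> K"
      using NQ[OF q] by (simp add: d_def Q_subset_K)
    ultimately have "(2::real) \<le> 1"
      using d(2)[OF q] rep(1)[OF NQ[OF q]]
      by (intro no_long_chord[of "(1/2) *\<^sub>R d q" "rep (\<iota> q)"]) (auto simp: Q_subset_K)
    then show False by simp
  qed
  have fibre: "card {q\<in>N. f (d q) = y} \<le> 2" for y
  proof (cases "{q\<in>N. f (d q) = y} = {}")
    case True
    then show ?thesis by (simp only: card.empty)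
  next
    case False
    then obtain q0 where q0: "q0 \<in> N" "f (d q0) = y" by blast
    define v where "v = d q0"
    have sign: "d q = v \<or> d q = - v" if "q \<in> N" "f (d q) = y" for q
    proof (rule ccontr)
      assume "\<not> ?thesis"
      then have ne: "v \<noteq> d q" "v \<noteq> - d q" by auto
      have "(1/2) *\<^sub>R (v + d q) \<in> L \<and> (1/2) *\<^sub>R (v - d q) \<in> L"
        using congr[OF d(1)[OF q0(1)] d(1)[OF that(1)]] q0(2) that(2) by (simp add: v_def)
      moreover have "rep (\<iota> q0) \<in> Q" "rep (\<iota> q0) + v \<in> Q" "rep (\<iota> q) \<in> Q" "rep (\<iota> q) + d q \<in> Q"
        using rep(1) NQ[OF q0(1)] NQ[OF that(1)] by (simp_all add: v_def d_def)
      ultimately show False using differences_not_congruent ne by blast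
    qed
    \<comment> \<open>\<open>u q\<close> is the end of the pair from which subtracting
      \<open>v\<close> leads to the other end. It is injective because a charged point is never a
      representative.\<close>
    define u where "u q = (if d q = v then q else rep (\<iota> q))" for q
    have "inj_on u {q\<in>N. f (d q) = y}"
    proof (rule inj_onI)
      fix q q' assume q: "q \<in> {q\<in>N. f (d q) = y}" and q': "q' \<in> {q\<in>N. f (d q) = y}" and eq: "u q = u q'"
      have N: "q \<in> N" "q' \<in> N" using q q' by auto
      have "q \<noteq> rep (\<iota> q')" "q' \<noteq> rep (\<iota> q)" using not_rep N by blast+
      moreover have "d q = v \<or> d q = - v" "d q' = v \<or> d q' = - v" using sign q q' by blast+
      ultimately have "d q = d q'" using eq by (metis u_def)
      then show "q = q'" using eq by (auto simp: u_def d_def split: if_splits)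
    qed
    moreover have "u ` {q\<in>N. f (d q) = y} \<subseteq> {p\<in>Q. p - v \<in> Q}"
    proof
      fix x assume "x \<in> u ` {q\<in>N. f (d q) = y}"
      then obtain q where q: "q \<in> N" "f (d q) = y" "x = u q" by auto
      show "x \<in> {p\<in>Q. p - v \<in> Q}"
      proof (cases "d q = v")
        case True
        then have "x = q" "q - v = rep (\<iota> q)" using q by (auto simp: u_def d_def)
        then show ?thesis using NQ rep(1) q by auto
      next
        case False
        then have x: "x = rep (\<iota> q)" and "d q = - v" using sign q by (auto simp only: u_def if_False)
        then have "x - v = q" by (simp add: d_def algebra_simps)
        moreover have "x \<in> Q" using rep(1)[OF NQ[OF q(1)]] x by simp
        ultimately show ?thesis using NQ[OF q(1)] by simp
      qed
    qed
    ultimately have "card {q\<in>N. f (d q) = y} \<le> card {p\<in>Q. p - v \<in> Q}"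
      using finite_Q by (intro card_inj_on_le[of u]) auto
    also have "\<dots> \<le> 2" using card_pairs_with_difference d q0(1) by (simp add: v_def)
    finally show ?thesis .
  qed
  \<comment> \<open>Three nonzero classes, each charged at most twice, account for the 6.\<close>
  have "N = (\<Union>y\<in>R - {z}. {q\<in>N. f (d q) = y})" using R(4) d(1) fz by auto
  then have "card N \<le> (\<Sum>y\<in>R - {z}. card {q\<in>N. f (d q) = y})"
    using R(1) card_UN_le[of "R - {z}" "\<lambda>y. {q\<in>N. f (d q) = y}"] by simp
  also have "\<dots> \<le> (\<Sum>y\<in>R - {z}. 2)" by (intro sum_mono fibre)
  also have "\<dots> = 6" using R by simp
  finally have "card N \<le> 6" .
  moreover have "card Q = card (Q - N) + card N"
    using finite_Q fin card_Diff_subset[OF fin, of Q] card_mono[OF finite_Q, of N] NQ by force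
  ultimately show ?thesis using 1 by simp
qed

end

section \<open>Lattice coordinates and discreteness\<close>

definition lattice_point :: "'a::real_vector set \<Rightarrow> ('a \<Rightarrow> int) \<Rightarrow> 'a" where
  "lattice_point B c = (\<Sum>b\<in>B. of_int (c b) *\<^sub>R b)"

lemma lattice_point_uminus: "- lattice_point B c = lattice_point B (\<lambda>b. - c b)"
  by (simp add: lattice_point_def sum_negf)

lemma lattice_point_add: "lattice_point B c + lattice_point B d = lattice_point B (\<lambda>b. c b + d b)"
  by (simp add: lattice_point_def sum.distrib scaleR_add_left)

lemma lattice_point_half:
  assumes "\<And>b. b \<in> B \<Longrightarrow> even (c b)"
  shows "(1/2) *\<^sub>R lattice_point B c = lattice_point B (\<lambda>b. c b div 2)"
proof -
  have "real_of_int (c b) / 2 = real_of_int (c b div 2)" if "b \<in> B" for b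
    using assms[OF that] by (auto elim!: evenE)
  then show ?thesis by (simp add: lattice_point_def scaleR_sum_right)
qed

text \<open>The coordinate functionals dual to \<open>B\<close> are bounded on \<open>A\<close>, so
  each integer coordinate takes finitely many values.\<close>

lemma finite_bounded_Int_lattice:
  fixes B :: "'a::euclidean_space set"
  assumes indep: "independent B" and "bounded A"
  shows "finite (A \<inter> range (lattice_point B))"
proof -
  have finB: "finite B" using indep by (rule independent_imp_finite)
  obtain m where m: "\<And>x. x \<in> A \<Longrightarrow> norm x \<le> m" using assms(2) by (auto simp: bounded_iff)
  have "\<exists>N::int. \<forall>c. lattice_point B c \<in> A \<longrightarrow> c b \<in> {-N..N}" if b: "b \<in> B" for b
  proof -
    obtain g :: "'a \<Rightarrow> real" where g: "linear g" "\<forall>x\<in>B. g x = (if x = b then 1 else 0)"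
      using linear_independent_extend[OF indep, of "\<lambda>x. if x = b then 1 else 0"] by blast
    obtain M where M: "M > 0" "\<And>x. norm (g x) \<le> M * norm x" using linear_bounded_pos[OF g(1)] by blast
    have gc: "g (lattice_point B c) = of_int (c b)" for c
    proof -
      have "g (lattice_point B c) = (\<Sum>x\<in>B. of_int (c x) * g x)"
        by (simp add: lattice_point_def linear_sum[OF g(1)] linear_cmul[OF g(1)])
      also have "\<dots> = (\<Sum>x\<in>B. if x = b then of_int (c x) else 0)"
        using g(2) by (intro sum.cong) auto
      finally show ?thesis using finB b by simp
    qed
    have "c b \<in> {- \<lceil>M * m\<rceil>..\<lceil>M * m\<rceil>}" if "lattice_point B c \<in> A" for c
    proof -
      have "M * norm (lattice_point B c) \<le> M * m" using m[OF that] M(1) by simp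
      then have "\<bar>of_int (c b)\<bar> \<le> M * m"
        using M(2)[of "lattice_point B c"] by (simp add: gc)
      then show ?thesis by (auto simp: le_ceiling_iff abs_le_iff) linarith+
    qed
    then show ?thesis by blast
  qed
  then obtain N :: "'a \<Rightarrow> int" where N: "\<And>b c. b \<in> B \<Longrightarrow> lattice_point B c \<in> A \<Longrightarrow> c b \<in> {- N b..N b}"
    by metis
  have "A \<inter> range (lattice_point B) \<subseteq> lattice_point B ` (PiE B (\<lambda>b. {- N b..N b}))"
  proof
    fix x assume "x \<in> A \<inter> range (lattice_point B)"
    then obtain c where c: "x = lattice_point B c" "lattice_point B c \<in> A" by blast
    \<comment> \<open>Restricting to \<open>B\<close> places the coefficient function in a finite
      product.\<close>
    have "x = lattice_point B (restrict c B)" by (simp add: c(1) lattice_point_def)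
    moreover have "restrict c B \<in> PiE B (\<lambda>b. {- N b..N b})" using N c(2) by auto
    ultimately show "x \<in> lattice_point B ` (PiE B (\<lambda>b. {- N b..N b}))" by blast
  qed
  moreover have "finite (lattice_point B ` (PiE B (\<lambda>b. {- N b..N b})))"
    using finB by (intro finite_imageI finite_PiE) auto
  ultimately show ?thesis by (rule finite_subset)
qed

section \<open>The bound for planar crystals\<close>

theorem theorem4p4:
  fixes k :: nat and S :: "(real ^ 2) set"
  assumes "k \<ge> 1"
    and "is_crystal k S"
  shows "helly_number S \<le> enat (k + 6)"
proof -
  obtain \<Lambda> t where "full_rank_lattice \<Lambda>" and S_def: "S = (\<Union>i\<in>{1..k}. (\<lambda>x. x + t i) ` \<Lambda>)"
    using assms(2) unfolding is_crystal_def by blast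
  then obtain B where B: "independent B" "span B = UNIV" "\<Lambda> = range (lattice_point B)"
    unfolding full_rank_lattice_def lattice_point_def by (auto simp: full_SetCompr_eq)
  have finB: "finite B" using B(1) by (rule independent_imp_finite)
  have "card B = 2" using dim_span_eq_card_independent[OF B(1)] B(2) by simp
  have uminus: "- v \<in> \<Lambda>" if "v \<in> \<Lambda>" for v using that B(3) by (auto simp: lattice_point_uminus)
  have add: "v + w \<in> \<Lambda>" if "v \<in> \<Lambda>" "w \<in> \<Lambda>" for v w using that B(3) by (auto simp: lattice_point_add)
  have diff: "v - w \<in> \<Lambda>" if "v \<in> \<Lambda>" "w \<in> \<Lambda>" for v w using add[OF that(1) uminus[OF that(2)]] by simp
  have S_iff: "x \<in> S \<longleftrightarrow> (\<exists>i\<in>{1..k}. x - t i \<in> \<Lambda>)" for x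
  proof -
    have "x \<in> (\<lambda>x. x + t i) ` \<Lambda> \<longleftrightarrow> x - t i \<in> \<Lambda>" for i
      by (metis (no_types, lifting) diff_add_cancel add_diff_cancel image_iff)
    then show ?thesis unfolding S_def by blast
  qed
  define c where "c = inv (lattice_point B)"
  have c: "lattice_point B (c v) = v" if "v \<in> \<Lambda>" for v
    using that B(3) by (simp add: c_def f_inv_into_f)
  \<comment> \<open>The set of odd coordinates encodes the class modulo 2: as
    \<open>card B = 2\<close> there are four classes, and \<open>{}\<close> is the zero
    class.\<close>
  define parity where "parity v = {b\<in>B. odd (c v b)}" for v
  have half: "(1/2) *\<^sub>R v \<in> \<Lambda>" if "v \<in> \<Lambda>" "parity v = {}" for v
    using lattice_point_half[of B "c v"] c[OF that(1)] that(2) B(3) by (auto simp: parity_def)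
  have congr: "(1/2) *\<^sub>R (v + w) \<in> \<Lambda>" if "v \<in> \<Lambda>" "w \<in> \<Lambda>" "parity v = parity w" for v w
  proof -
    have "even (c v b + c w b)" if "b \<in> B" for b
      using \<open>parity v = parity w\<close> that by (auto simp: parity_def)
    then have "(1/2) *\<^sub>R lattice_point B (\<lambda>b. c v b + c w b) \<in> \<Lambda>"
      using B(3) by (simp add: lattice_point_half)
    then show ?thesis using c that by (simp flip: lattice_point_add)
  qed
  have congr': "(1/2) *\<^sub>R (v + w) \<in> \<Lambda> \<and> (1/2) *\<^sub>R (v - w) \<in> \<Lambda>"
    if "v \<in> \<Lambda>" "w \<in> \<Lambda>" "parity v = parity w" for v w
  proof -
    have "(1/2) *\<^sub>R (v - w) = (1/2) *\<^sub>R (v + w) - w" by (simp add: vec_eq_iff)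
    then show ?thesis using congr[OF that] diff that(2) by simp
  qed
  have "helly_property S (k + 6)"
  proof (rule helly_property_if_empty_polytopes_small)
    fix A :: "(real^2) set" assume "bounded A"
    have "finite (A \<inter> (\<lambda>x. x + t i) ` \<Lambda>)" for i
    proof -
      have "bounded ((\<lambda>x. - t i + x) ` A)" using \<open>bounded A\<close> by (rule bounded_translation)
      then have "finite ((\<lambda>x. x + t i) ` ((\<lambda>x. - t i + x) ` A \<inter> \<Lambda>))"
        using finite_bounded_Int_lattice[OF B(1)] B(3) by simp
      moreover have "A \<inter> (\<lambda>x. x + t i) ` \<Lambda> \<subseteq> (\<lambda>x. x + t i) ` ((\<lambda>x. - t i + x) ` A \<inter> \<Lambda>)"
      proof
        fix x assume x: "x \<in> A \<inter> (\<lambda>x. x + t i) ` \<Lambda>"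
        then obtain y where y: "y \<in> \<Lambda>" "x = y + t i" by blast
        then have "y = - t i + x" by simp
        with x y show "x \<in> (\<lambda>x. x + t i) ` ((\<lambda>x. - t i + x) ` A \<inter> \<Lambda>)" by blast
      qed
      ultimately show ?thesis by (rule finite_subset[rotated])
    qed
    then have "finite (\<Union>i\<in>{1..k}. A \<inter> (\<lambda>x. x + t i) ` \<Lambda>)" by (intro finite_UN_I) auto
    then show "finite (A \<inter> S)" by (simp only: S_def Int_UN_distrib)
  next
    fix Q assume Q: "finite Q" "Q \<subseteq> S" "convex_position Q" "convex hull Q \<inter> S \<subseteq> Q"
    show "card Q \<le> k + 6"
    \<comment> \<open>At most four vertices satisfy the bound outright; larger polygons fall under
      the locale.\<close>
    proof (cases "4 < card Q")
      case True
      interpret empty_polygon \<Lambda> S Q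
      proof
        show "x + v \<in> S" if "x \<in> S" "v \<in> \<Lambda>" for x v
          using that add[of "x - t _" v] unfolding S_iff by (metis diff_add_eq)
      qed (use Q True uminus in auto)
      have "\<forall>q\<in>Q. \<exists>i\<in>{1..k}. q - t i \<in> \<Lambda>" using Q(2) S_iff by blast
      then obtain \<iota> where \<iota>: "\<And>q. q \<in> Q \<Longrightarrow> \<iota> q \<in> {1..k}" "\<And>q. q \<in> Q \<Longrightarrow> q - t (\<iota> q) \<in> \<Lambda>"
        by metis
      have coset: "p - q \<in> \<Lambda>" if "p \<in> Q" "q \<in> Q" "\<iota> p = \<iota> q" for p q
        using diff[OF \<iota>(2)[OF that(1)] \<iota>(2)[OF that(2)]] that(3) by simp
      have "card (Pow B) = 4" using finB \<open>card B = 2\<close> by (simp add: card_Pow)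
      moreover have "parity v \<in> Pow B" for v by (auto simp: parity_def)
      ultimately have "card Q \<le> card {1..k} + 6"
        using finB \<iota>(1) coset half congr'
        by (intro card_le_cosets[where \<iota> = \<iota> and f = parity and R = "Pow B" and z = "{}"]) simp_all
      then show ?thesis by simp
    qed simp
  qed simp
  then have "enat (k + 6) \<in> {enat n |n. n \<ge> 1 \<and> helly_property S n}" by auto
  then show ?thesis unfolding helly_number_def by (rule Inf_lower)
qed

end
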